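(* Let $\mathcal{S}\subseteq 2^{[n]}$ be an arbitrary set system, $p\ge0$ and $\epsilon\in(0,1)$. In the entry-wise update model for a vector $v\in\mathbb{R}^n$, there exists an algorithm that uses $O\big(\mathrm{HHdim}(\mathcal{S})\cdot\epsilon^{-2}\cdot\log|\mathcal{S}|\big)$ words of space and, for each query $s\in\mathcal{S}$, outputs a $(1\pm\epsilon)$-approximation to $\|s\circ v\|_p$ with probability at least $0.9$.
   Context: In the entry-wise update model, each coordinate $i$ of $v$ appears in the stream at most once, together with its final value $v_i$. Subsets of $[n]$ are identified with $0/1$ vectors; $u\circ v$ is the coordinatewise product, $\operatorname{supp}(v)=\{i:v_i\neq0\}$, $\|v\|_0=|\operatorname{supp}(v)|$ and $\|v\|_p=(\sum_i|v_i|^p)^{1/p}$ for $p>0$. $H(\mathcal{S},v)=\{i\in[n]:\exists s\in\mathcal{S}\text{ with }\operatorname{supp}(s\circ v)=\{i\}\}$ and $\mathrm{HHdim}(\mathcal{S})=\sup_{v\in\mathbb{R}^n}|H(\mathcal{S},v)|$. $\mathcal{S}$ is available to the algorithm in advance.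
   Formalization: Words have b bits with n ≤ 2^b, and nonzero entries of v satisfy 2^-b ≤ |v_i| ≤ 2^b (the claim fails for unbounded range); log|S| is read as max(1, log2|S|); the O-constant may depend on p; space counts memory kept between updates. *)

theory Defs
  imports "HOL-Probability.Probability"
begin

text \<open>
  Vectors of dimension \<open>n\<close> are functions \<open>nat \<Rightarrow> real\<close> read on the coordinates \<open>{1..n}\<close>; a subset
  \<open>s\<close> of \<open>{1..n}\<close> is turned into a 0/1 vector by \<open>indicat_real s\<close>.
\<close>

type_synonym rvec = "nat \<Rightarrow> real"

definition cprod :: "rvec \<Rightarrow> rvec \<Rightarrow> rvec"
  where "cprod u v = (\<lambda>i. u i * v i)"

definition vsupp :: "nat \<Rightarrow> rvec \<Rightarrow> nat set"
  where "vsupp n v = {i \<in> {1..n}. v i \<noteq> 0}"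

definition lpnorm :: "nat \<Rightarrow> real \<Rightarrow> rvec \<Rightarrow> real"
  where "lpnorm n p v =
    (if p = 0 then real (card (vsupp n v))
     else (\<Sum>i = 1..n. \<bar>v i\<bar> powr p) powr (1 / p))"

definition hhset :: "nat \<Rightarrow> nat set set \<Rightarrow> rvec \<Rightarrow> nat set"
  where "hhset n S v = {i \<in> {1..n}. \<exists>s\<in>S. vsupp n (cprod (indicat_real s) v) = {i}}"

definition HHdim :: "nat \<Rightarrow> nat set set \<Rightarrow> nat"
  where "HHdim n S = (SUP v. card (hhset n S v))"

text \<open>The supremum on \<open>nat\<close> in \<open>HHdim\<close> is a genuine one, since the family is bounded.\<close>

lemma hhset_card_le: "card (hhset n S v) \<le> n"
proof -
  have "card (hhset n S v) \<le> card {1..n}"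
    by (rule card_mono) (auto simp: hhset_def)
  then show ?thesis by simp
qed

lemma bdd_above_hhset: "bdd_above (range (\<lambda>v. card (hhset n S v)))"
  by (rule bdd_aboveI2[where M = n]) (rule hhset_card_le)

text \<open>
  Entry-wise updates: a coordinate occurs at most once, together with its final value, in an
  arbitrary order; a coordinate that never occurs has value 0.
\<close>

definition entrywise_stream :: "nat \<Rightarrow> rvec \<Rightarrow> (nat \<times> real) list \<Rightarrow> bool"
  where "entrywise_stream n v xs \<longleftrightarrow>
    distinct (map fst xs) \<and>
    (\<forall>(i, x) \<in> set xs. i \<in> {1..n} \<and> x = v i) \<and>
    (\<forall>i \<in> {1..n}. i \<notin> fst ` set xs \<longrightarrow> v i = 0)"

text \<open>
  A word has \<open>b\<close> bits. Words able to hold arbitrary reals would make every space bound void, as a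
  whole vector can be encoded in one real number; with \<open>b\<close>-bit words, conversely, the magnitudes of
  the nonzero entries have to lie in a range whose exponents are of order \<open>b\<close>. The entries
  themselves remain real numbers of unlimited precision.
\<close>

definition word_range :: "nat \<Rightarrow> nat \<Rightarrow> rvec \<Rightarrow> bool"
  where "word_range b n v \<longleftrightarrow>
    (\<forall>i \<in> {1..n}. v i \<noteq> 0 \<longrightarrow> 1 / 2 ^ b \<le> \<bar>v i\<bar> \<and> \<bar>v i\<bar> \<le> 2 ^ b)"

definition memory :: "nat \<Rightarrow> nat \<Rightarrow> nat list set"
  where "memory b m = {ws. length ws = m \<and> set ws \<subseteq> {..<2 ^ b}}"

text \<open>
  Randomized streaming algorithms. Coins are tossed on the fly, so whatever randomness is to be
  reused later has to be kept in memory. The answer depends on the queried set and the final memory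
  contents only.
\<close>

record stream_alg =
  sa_init :: "nat list pmf"
  sa_update :: "nat \<times> real \<Rightarrow> nat list \<Rightarrow> nat list pmf"
  sa_answer :: "nat set \<Rightarrow> nat list \<Rightarrow> real pmf"

definition uses_words :: "nat \<Rightarrow> nat \<Rightarrow> stream_alg \<Rightarrow> bool"
  where "uses_words b m A \<longleftrightarrow>
    set_pmf (sa_init A) \<subseteq> memory b m \<and>
    (\<forall>u. \<forall>\<sigma> \<in> memory b m. set_pmf (sa_update A u \<sigma>) \<subseteq> memory b m)"

primrec run_updates :: "stream_alg \<Rightarrow> (nat \<times> real) list \<Rightarrow> nat list \<Rightarrow> nat list pmf"
  where
    "run_updates A [] \<sigma> = return_pmf \<sigma>"
  | "run_updates A (u # us) \<sigma> = bind_pmf (sa_update A u \<sigma>) (run_updates A us)"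

definition query_output :: "stream_alg \<Rightarrow> (nat \<times> real) list \<Rightarrow> nat set \<Rightarrow> real pmf"
  where "query_output A us s =
    bind_pmf (sa_init A) (\<lambda>\<sigma>. bind_pmf (run_updates A us \<sigma>) (sa_answer A s))"

definition rel_approx :: "real \<Rightarrow> real \<Rightarrow> real set"
  where "rel_approx \<epsilon> z = {y. (1 - \<epsilon>) * z \<le> y \<and> y \<le> (1 + \<epsilon>) * z}"

end

theory Submission
  imports Defs
begin

text \<open>
  Let \<open>z\<close> be the sum of \<open>\<bar>v i\<bar> powr p\<close> over \<open>i \<in> s\<close>. If coordinate \<open>i\<close> is put into a random set \<open>T\<close>
  with probability \<open>1 - exp (- \<theta> \<bar>v i\<bar> powr p)\<close>, independently, then \<open>s\<close> misses \<open>T\<close> with probability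
  \<open>exp (- \<theta> z)\<close>. So the norm can be read off the empirical frequency with which \<open>s\<close> misses \<open>T\<close>, taken
  over \<open>O(1/\<epsilon>\<^sup>2)\<close> copies at each of \<open>O(b)\<close> dyadic scales \<open>\<theta>\<close>. The variances of the misses at all
  scales telescope to at most 1, hence Chebyshev's inequality makes all scales accurate at once.

  Of each \<open>T\<close> only the family of those members of \<open>S\<close> which meet \<open>T\<close> is remembered. A collection of
  sets shattered by such families contains, for each of its members, a point lying in no other member,
  so its size is at most \<open>HHdim n S\<close>. By Sauer's lemma there are at most \<open>(card S + 1) ^ HHdim n S\<close>
  families, and a copy costs \<open>O(HHdim n S * log (card S))\<close> bits; the \<open>O(b)\<close> scales of a copy together
  fit into \<open>O(HHdim n S * log (card S))\<close> words of \<open>b\<close> bits.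
\<close>

section \<open>Sauer's lemma and hit families\<close>

definition shatters :: "'a set set \<Rightarrow> 'a set \<Rightarrow> bool"
  where "shatters F A \<longleftrightarrow> (\<forall>B\<subseteq>A. \<exists>X\<in>F. A \<inter> X = B)"

lemma shattersE:
  assumes "shatters F A" "B \<subseteq> A"
  obtains X where "X \<in> F" "A \<inter> X = B"
  using assms by (auto simp: shatters_def)

text \<open>Induction on the ground set. Deleting \<open>x\<close> splits the count of
  \<open>F\<close> into the traces \<open>F0\<close> and the sets \<open>F1\<close> that occur in
  \<open>F\<close> both with and without \<open>x\<close>. Anything shattered by \<open>F1\<close>
  can be enlarged by \<open>x\<close>, so \<open>F1\<close> satisfies the bound with
  \<open>d - 1\<close>. The form \<open>(card S + 1) ^ d\<close> is a coarse but convenient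
  substitute for the binomial sum.\<close>

lemma card_le_of_shatters_bound:
  assumes "finite S" "F \<subseteq> Pow S" "\<And>A. A \<subseteq> S \<Longrightarrow> shatters F A \<Longrightarrow> card A \<le> d"
  shows "card F \<le> (card S + 1) ^ d"
  using assms
proof (induction S arbitrary: F d rule: finite_induct)
  case empty
  then have "F \<subseteq> {{}}" by auto
  then have "card F \<le> card {{}::'a set}" by (intro card_mono) auto
  then show ?case by simp
next
  case (insert x S)
  define F0 where "F0 = (\<lambda>X. X - {x}) ` F"
  define F1 where "F1 = {X \<in> F. x \<notin> X \<and> insert x X \<in> F}"
  have finF: "finite F" using insert.hyps insert.prems(1) finite_subset by blast
  have sub: "F0 \<subseteq> Pow S" "F1 \<subseteq> Pow S"
    using insert.prems(1) by (auto simp: F0_def F1_def)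
  \<comment> \<open>Deleting \<open>x\<close> merges exactly the pairs counted by \<open>F1\<close>;
    with the copy containing \<open>x\<close> removed from each pair, nothing is merged and every
    trace is still attained.\<close>
  have "inj_on (\<lambda>X. X - {x}) (F - insert x ` F1)"
  proof (rule inj_onI)
    fix X Y assume XY: "X \<in> F - insert x ` F1" "Y \<in> F - insert x ` F1" "X - {x} = Y - {x}"
    have *: "\<not> (x \<in> X' \<and> x \<notin> Y')"
      if "X' \<in> F - insert x ` F1" "Y' \<in> F - insert x ` F1" "X' - {x} = Y' - {x}" for X' Y'
    proof
      assume "x \<in> X' \<and> x \<notin> Y'"
      then have "X' = insert x Y'" "Y' \<in> F1" using that by (auto simp: F1_def insert_absorb)
      then show False using that by blast
    qed
    show "X = Y" using *[OF XY] *[OF XY(2,1) XY(3)[symmetric]] XY(3) by blast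
  qed
  moreover have "(\<lambda>X. X - {x}) ` (F - insert x ` F1) = F0"
  proof
    show "F0 \<subseteq> (\<lambda>X. X - {x}) ` (F - insert x ` F1)"
    proof
      fix Y assume "Y \<in> F0"
      then obtain X where X: "X \<in> F" "Y = X - {x}" by (auto simp: F0_def)
      show "Y \<in> (\<lambda>X. X - {x}) ` (F - insert x ` F1)"
      proof (cases "X \<in> insert x ` F1")
        case True
        then have "Y \<in> F" "x \<notin> Y" using X by (auto simp: F1_def)
        then have "Y \<in> F - insert x ` F1" "Y = Y - {x}" by auto
        then show ?thesis by blast
      next
        case False
        then show ?thesis using X by blast
      qed
    qed
  qed (auto simp: F0_def)
  ultimately have c0: "card (F - insert x ` F1) = card F0"
    by (metis card_image)
  have "inj_on (insert x) F1"
    by (auto simp: inj_on_def F1_def)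
  then have c1: "card (insert x ` F1) = card F1" by (rule card_image)
  have F1F: "insert x ` F1 \<subseteq> F" by (auto simp: F1_def)
  then have cardF: "card F = card F0 + card F1"
    using card_Diff_subset[OF finite_subset[OF F1F finF] F1F] card_mono[OF finF F1F] c0 c1 by linarith
  have sh0: "shatters F A" if A: "A \<subseteq> S" "shatters F0 A" for A
    unfolding shatters_def
  proof (intro allI impI)
    fix B assume "B \<subseteq> A"
    then obtain Y where Y: "Y \<in> F0" "A \<inter> Y = B"
      by (rule shattersE[OF A(2)])
    then obtain X where "X \<in> F" "Y = X - {x}" by (auto simp: F0_def)
    then show "\<exists>X\<in>F. A \<inter> X = B" using Y A(1) insert.hyps by blast
  qed
  \<comment> \<open>A member of \<open>F1\<close> with the right trace on \<open>A\<close> lies in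
    \<open>F\<close> with and without \<open>x\<close>, so membership of \<open>x\<close> can be
    prescribed freely.\<close>
  have sh1: "shatters F (insert x A)" if A: "A \<subseteq> S" "shatters F1 A" for A
    unfolding shatters_def
  proof (intro allI impI)
    fix B assume B: "B \<subseteq> insert x A"
    then have "B - {x} \<subseteq> A" by auto
    then obtain X where X: "X \<in> F1" "A \<inter> X = B - {x}"
      by (rule shattersE[OF A(2)])
    show "\<exists>X\<in>F. insert x A \<inter> X = B"
    proof (cases "x \<in> B")
      case True
      then have "insert x X \<in> F" "insert x A \<inter> insert x X = B" using X B by (auto simp: F1_def)
      then show ?thesis by blast
    next
      case False
      then have "X \<in> F" "insert x A \<inter> X = B" using X B by (auto simp: F1_def)
      then show ?thesis by blast
    qed
  qed
  have b0: "card F0 \<le> (card S + 1) ^ d"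
    by (rule insert.IH[OF sub(1)]) (use sh0 insert.prems(2) in blast)
  have b1: "card A < d" if "A \<subseteq> S" "shatters F1 A" for A
  proof -
    have "card (insert x A) \<le> d"
      using that by (intro insert.prems(2) sh1) auto
    moreover have "card (insert x A) = Suc (card A)"
      using that insert.hyps by (meson card_insert_disjoint finite_subset subsetD)
    ultimately show ?thesis by simp
  qed
  show ?case
  proof (cases d)
    \<comment> \<open>There is no \<open>d - 1\<close> here; instead even the empty set would be too
      large to be shattered by \<open>F1\<close>, which forces \<open>F1\<close> to be
      empty.\<close>
    case 0
    have "F1 = {}"
    proof (rule ccontr)
      assume "F1 \<noteq> {}"
      then have "shatters F1 {}" by (auto simp: shatters_def)
      then show False using b1[of "{}"] 0 by simp
    qed
    then show ?thesis using cardF b0 0 by simp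
  next
    case (Suc e)
    have "card F1 \<le> (card S + 1) ^ e"
    proof (rule insert.IH[OF sub(2)])
      fix A assume "A \<subseteq> S" "shatters F1 A"
      from b1[OF this] show "card A \<le> e" using Suc by simp
    qed
    then have "card F \<le> (card S + 1) ^ d + (card S + 1) ^ e"
      using cardF b0 by simp
    also have "\<dots> = (card S + 2) * (card S + 1) ^ e"
      using Suc by simp
    also have "\<dots> \<le> (card S + 2) * (card S + 2) ^ e"
      by (intro mult_left_mono power_mono) auto
    finally show ?thesis using insert.hyps Suc by simp
  qed
qed

section \<open>Hit families of a set system and their number\<close>

definition hit_family :: "nat set set \<Rightarrow> nat set \<Rightarrow> nat set set"
  where "hit_family S X = {s \<in> S. s \<inter> X \<noteq> {}}"

lemma card_shattered_by_hit_families: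
  assumes S: "S \<subseteq> Pow {1..n}" and A: "A \<subseteq> S" "shatters (range (hit_family S)) A"
  shows "card A \<le> HHdim n S"
proof -
  have "\<exists>x. x \<in> s \<and> (\<forall>t\<in>A. x \<in> t \<longrightarrow> t = s)" if "s \<in> A" for s
  proof -
    have "{s} \<subseteq> A" using that by simp
    then obtain X where X: "A \<inter> hit_family S X = {s}"
      using shattersE[OF A(2)] by (metis rangeE)
    then have "s \<in> hit_family S X" by auto
    then obtain x where x: "x \<in> s" "x \<in> X" by (auto simp: hit_family_def)
    have "t = s" if "t \<in> A" "x \<in> t" for t
      using X that x A(1) by (auto simp: hit_family_def)
    then show ?thesis using x by blast
  qed
  then obtain x where x: "\<And>s. s \<in> A \<Longrightarrow> x s \<in> s" "\<And>s t. s \<in> A \<Longrightarrow> t \<in> A \<Longrightarrow> x s \<in> t \<Longrightarrow> t = s"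
    by metis
  \<comment> \<open>The vector supported on the private points: each \<open>s\<close> in
    \<open>A\<close> meets this support in \<open>x s\<close> alone, so every private point is a
    heavy hitter of \<open>v\<close>.\<close>
  define v where "v = indicat_real (x ` A)"
  have "x ` A \<subseteq> hhset n S v"
  proof
    fix i assume "i \<in> x ` A"
    then obtain s where s: "s \<in> A" "i = x s" by auto
    have "s \<subseteq> {1..n}" using s(1) A(1) S by blast
    then have i: "i \<in> {1..n}" "i \<in> s" using s x(1)[OF s(1)] by auto
    have *: "j = i" if "j \<in> s" "j \<in> x ` A" for j
      using that s x(2) by auto
    have "vsupp n (cprod (indicat_real s) v) = {j \<in> {1..n}. j \<in> s \<and> j \<in> x ` A}"
      by (simp add: vsupp_def cprod_def v_def indicator_def)
    also have "\<dots> = {i}" using * i \<open>i \<in> x ` A\<close> by blast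
    finally have "vsupp n (cprod (indicat_real s) v) = {i}" .
    then show "i \<in> hhset n S v" using i(1) s(1) A(1) unfolding hhset_def by blast
  qed
  then have "card (x ` A) \<le> card (hhset n S v)"
    by (rule card_mono[rotated]) (auto simp: hhset_def)
  moreover have "inj_on x A" using x by (metis inj_onI)
  moreover have "card (hhset n S v) \<le> HHdim n S"
    unfolding HHdim_def by (rule cSUP_upper) (auto intro: bdd_above_hhset)
  ultimately show ?thesis by (simp add: card_image)
qed

text \<open>Sauer's lemma is used in dual form: the points of the ground set are the members of
  \<open>S\<close>, and its subsets are the hit families.\<close>

lemma card_hit_families:
  assumes "S \<subseteq> Pow {1..n}"
  shows "card (range (hit_family S)) \<le> (card S + 1) ^ HHdim n S"
proof (rule card_le_of_shatters_bound)
  show "finite S" using assms finite_subset by auto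
  show "range (hit_family S) \<subseteq> Pow S" by (auto simp: hit_family_def)
qed (use card_shattered_by_hit_families[OF assms] in blast)

section \<open>Inverting exponential frequencies at dyadic scales\<close>

text \<open>The least \<open>k\<close> with \<open>y <= 2 ^ k\<close> works: for positive
  \<open>k\<close> minimality bounds \<open>y\<close> from below, and for \<open>k = 0\<close> the
  assumption \<open>1 <= y\<close> does.\<close>

lemma dyadic_scale_exists:
  fixes y :: real
  assumes "1 \<le> y" "y \<le> 2 ^ M"
  shows "\<exists>k\<le>M. 1 / 2 \<le> y / 2 ^ k \<and> y / 2 ^ k \<le> 1"
proof -
  define k where "k = (LEAST k. y \<le> 2 ^ k)"
  have k: "y \<le> 2 ^ k" "k \<le> M"
    unfolding k_def using assms by (auto intro: LeastI Least_le)
  have "2 ^ k \<le> 2 * y"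
  proof (cases k)
    case (Suc l)
    then have "\<not> y \<le> 2 ^ l" using not_less_Least[of l "\<lambda>k. y \<le> 2 ^ k"] by (simp add: k_def)
    then show ?thesis using Suc by simp
  qed (use assms in simp)
  then show ?thesis using k by (intro exI[of _ k]) (simp add: field_simps)
qed

text \<open>Multiplying by \<open>exp x <= 3\<close> turns the hypothesis into a bound on
  \<open>1 - exp (x - x')\<close>, whence an absolute error of at most \<open>12 * \<delta>\<close>.
  Since \<open>x >= 1/2\<close>, this is a relative error of at most
  \<open>24 * \<delta>\<close>.\<close>

lemma exp_minus_close_imp_close:
  fixes x x' \<delta> :: real
  assumes x: "1 / 2 \<le> x" "x \<le> 1" and "0 \<le> x'" "\<delta> \<le> 1 / 32"
    and close: "\<bar>exp (- x) - exp (- x')\<bar> \<le> 2 * \<delta>"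
  shows "\<bar>x' - x\<bar> \<le> 32 * \<delta> * x"
proof -
  have \<delta>: "0 \<le> \<delta>" using close by linarith
  have "exp x \<le> exp 1" using x by simp
  then have ex: "exp x \<le> 3" using exp_le by linarith
  have "exp x * \<bar>exp (- x) - exp (- x')\<bar> \<le> 3 * (2 * \<delta>)"
    by (rule mult_mono) (use ex close in auto)
  moreover have "exp x * \<bar>exp (- x) - exp (- x')\<bar> = \<bar>1 - exp (x - x')\<bar>"
    by (simp add: abs_mult_pos' right_diff_distrib exp_minus exp_diff divide_inverse)
  ultimately have *: "\<bar>1 - exp (x - x')\<bar> \<le> 6 * \<delta>" by simp
  have dx: "\<delta> \<le> 2 * \<delta> * x" using mult_left_mono[OF x(1) \<delta>] by simp
  show ?thesis
  proof (cases "x' \<le> x")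
    case True
    have "x - x' \<le> exp (x - x') - 1" using exp_ge_add_one_self[of "x - x'"] by linarith
    then have "x - x' \<le> 6 * \<delta>" using * True by linarith
    then show ?thesis using True dx \<delta> by linarith
  next
    case False
    \<comment> \<open>No upper bound on \<open>x'\<close> is available, so \<open>t\<close> is
      bounded through \<open>(1 + t) * exp (- t) <= 1\<close>; the smallness of
      \<open>\<delta>\<close> keeps the factor \<open>1 - 6 * \<delta>\<close> above
      \<open>1/2\<close>.\<close>
    define t where "t = x' - x"
    have t: "0 < t" using False by (simp add: t_def)
    have "1 - exp (- t) \<le> 6 * \<delta>" using * by (simp add: t_def)
    then have "(1 + t) * (1 - 6 * \<delta>) \<le> exp t * exp (- t)"
      using t assms(4) exp_ge_add_one_self[of t] by (intro mult_mono) auto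
    then have "t * (1 - 6 * \<delta>) \<le> 6 * \<delta>" by (simp add: exp_minus algebra_simps)
    moreover have "t * (1 / 2) \<le> t * (1 - 6 * \<delta>)" using t assms(4) by (intro mult_left_mono) auto
    ultimately have "t \<le> 12 * \<delta>" by linarith
    then show ?thesis using dx \<delta> t unfolding t_def by linarith
  qed
qed

text \<open>Only the scale at which \<open>y / 2 ^ k\<close> lies between \<open>1/2\<close> and
  \<open>1\<close> is informative. It depends on \<open>y\<close>, so closeness is required at every
  scale.\<close>

lemma dyadic_exp_close_imp_close:
  fixes y y' \<delta> :: real
  assumes y: "1 \<le> y" "y \<le> 2 ^ M" and "0 \<le> y'" "\<delta> \<le> 1 / 32"
    and close: "\<And>k. k \<le> M \<Longrightarrow> \<bar>exp (- (y / 2 ^ k)) - exp (- (y' / 2 ^ k))\<bar> \<le> 2 * \<delta>"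
  shows "\<bar>y' - y\<bar> \<le> 32 * \<delta> * y"
proof -
  obtain k where k: "k \<le> M" "1 / 2 \<le> y / 2 ^ k" "y / 2 ^ k \<le> 1"
    using dyadic_scale_exists[OF y] by blast
  have "\<bar>y' / 2 ^ k - y / 2 ^ k\<bar> \<le> 32 * \<delta> * (y / 2 ^ k)"
    by (rule exp_minus_close_imp_close) (use k assms in auto)
  moreover have "\<bar>y' / 2 ^ k - y / 2 ^ k\<bar> = \<bar>y' - y\<bar> / 2 ^ k"
    by (simp add: diff_divide_distrib[symmetric])
  ultimately show ?thesis by (simp add: field_simps)
qed

text \<open>The square of each exponential is the exponential one scale earlier, so the sum
  telescopes. Hence a union bound over all scales costs no factor \<open>M\<close>.\<close>

lemma dyadic_exp_variance_sum:
  fixes y :: real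
  shows "(\<Sum>k\<le>M. exp (- (y / 2 ^ k)) * (1 - exp (- (y / 2 ^ k)))) = exp (- (y / 2 ^ M)) - exp (- 2 * y)"
proof (induction M)
  case 0
  show ?case by (simp add: algebra_simps flip: exp_add)
next
  case (Suc M)
  have "exp (- (y / 2 ^ Suc M)) * exp (- (y / 2 ^ Suc M)) = exp (- (y / 2 ^ M))"
    by (simp flip: exp_add)
  then show ?case using Suc by (simp add: algebra_simps)
qed

section \<open>From relative errors of power sums to relative errors of norms\<close>

definition power_to_norm :: "real \<Rightarrow> real \<Rightarrow> real"
  where "power_to_norm p z = (if p = 0 then z else z powr (1 / p))"

text \<open>For small \<open>p\<close> the root magnifies relative errors, so the power sum needs
  the sharper accuracy \<open>c * \<epsilon>\<close>. Both directions are compared at the level of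
  \<open>p\<close>-th powers of \<open>1 + \<epsilon>\<close> and \<open>1 - \<epsilon>\<close>;
  \<open>c\<close> depends on \<open>p\<close> only.\<close>

lemma power_to_norm_approx:
  fixes p :: real
  assumes "0 \<le> p"
  shows "\<exists>c>0. c < 1 \<and> (\<forall>\<epsilon> z z'. 0 < \<epsilon> \<longrightarrow> \<epsilon> < 1 \<longrightarrow> 0 \<le> z \<longrightarrow> \<bar>z' - z\<bar> \<le> c * \<epsilon> * z \<longrightarrow>
    power_to_norm p z' \<in> rel_approx \<epsilon> (power_to_norm p z))"
proof (cases "p = 0")
  case True
  have "z' \<in> rel_approx \<epsilon> z" if "0 < \<epsilon>" "0 \<le> z" "\<bar>z' - z\<bar> \<le> 1/2 * \<epsilon> * z" for \<epsilon> z z' :: real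
  proof -
    have "0 \<le> \<epsilon> * z" using that by simp
    then have "\<bar>z' - z\<bar> \<le> \<epsilon> * z" using that(3) by linarith
    then show ?thesis by (simp add: rel_approx_def algebra_simps abs_le_iff)
  qed
  then show ?thesis using True by (intro exI[of _ "1/2"]) (auto simp: power_to_norm_def)
next
  case False
  then have p: "0 < p" using assms by simp
  \<comment> \<open>Chosen so that \<open>c <= p / 2\<close>, which gives the upper estimate, and
    \<open>c * (1 + p) <= p\<close>, which gives the lower one.\<close>
  define c where "c = p / (2 * (1 + p))"
  have c: "0 < c" "c < 1" using p by (auto simp: c_def field_simps)
  have "power_to_norm p z' \<in> rel_approx \<epsilon> (power_to_norm p z)"
    if \<epsilon>: "0 < \<epsilon>" "\<epsilon> < 1" and z: "0 \<le> z" "\<bar>z' - z\<bar> \<le> c * \<epsilon> * z" for \<epsilon> z z'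
  proof -
    have up: "1 + c * \<epsilon> \<le> (1 + \<epsilon>) powr p"
    proof -
      have "\<epsilon> / 2 \<le> \<epsilon> / (1 + \<epsilon>)" using \<epsilon> by (simp add: field_simps)
      also have "\<dots> \<le> ln (1 + \<epsilon>)"
        using ln_le_minus_one[of "1 / (1 + \<epsilon>)"] \<epsilon>
        by (simp add: ln_div field_simps)
      finally have "p * (\<epsilon> / 2) \<le> p * ln (1 + \<epsilon>)" using p by simp
      moreover have "c * \<epsilon> \<le> p * (\<epsilon> / 2)"
      proof -
        have "c \<le> p / 2" using p by (simp add: c_def field_simps)
        then show ?thesis using \<epsilon> mult_right_mono[of c "p / 2" \<epsilon>] by simp
      qed
      ultimately have "1 + c * \<epsilon> \<le> 1 + p * ln (1 + \<epsilon>)" by linarith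
      also have "\<dots> \<le> exp (p * ln (1 + \<epsilon>))" by (rule exp_ge_add_one_self)
      finally show ?thesis using \<epsilon> by (simp add: powr_def)
    qed
    have low: "(1 - \<epsilon>) powr p \<le> 1 - c * \<epsilon>"
    proof -
      have "ln (1 - \<epsilon>) \<le> - \<epsilon>" using ln_le_minus_one[of "1 - \<epsilon>"] \<epsilon> by simp
      then have "p * ln (1 - \<epsilon>) \<le> - (p * \<epsilon>)" using p mult_left_mono[of "ln (1 - \<epsilon>)" "- \<epsilon>" p] by simp
      then have "(1 - \<epsilon>) powr p \<le> exp (- (p * \<epsilon>))" using \<epsilon> by (simp add: powr_def)
      also have "\<dots> \<le> 1 / (1 + p * \<epsilon>)"
        using exp_ge_add_one_self[of "p * \<epsilon>"] p \<epsilon>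
        by (simp add: exp_minus field_simps add_pos_pos)
      also have "\<dots> \<le> 1 - c * \<epsilon>"
      proof -
        have "c * (1 + p * \<epsilon>) \<le> c * (1 + p)" using c p \<epsilon> by (intro mult_left_mono) auto
        also have "\<dots> = p / 2" using p by (simp add: c_def field_simps)
        finally have "c * (1 + p * \<epsilon>) \<le> p" using p by linarith
        then have "c * (1 + p * \<epsilon>) * \<epsilon> \<le> p * \<epsilon>" using \<epsilon> by (intro mult_right_mono) auto
        then have "1 \<le> (1 - c * \<epsilon>) * (1 + p * \<epsilon>)" by (simp add: algebra_simps)
        then show ?thesis using p \<epsilon> by (simp add: divide_le_eq add_pos_pos)
      qed
      finally show ?thesis .
    qed
    have "c * \<epsilon> < 1" using c \<epsilon> mult_strict_mono[of c 1 \<epsilon> 1] by simp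
    then have "c * \<epsilon> * z \<le> z" using z mult_right_mono[of "c * \<epsilon>" 1 z] by simp
    then have z': "0 \<le> z'" using z by linarith
    have "(1 - \<epsilon>) * z powr (1 / p) = ((1 - \<epsilon>) powr p * z) powr (1 / p)"
      using p \<epsilon> z by (simp add: powr_mult powr_powr)
    also have "\<dots> \<le> z' powr (1 / p)"
    proof (rule powr_mono2)
      have "(1 - \<epsilon>) powr p * z \<le> (1 - c * \<epsilon>) * z" using low z by (intro mult_right_mono) auto
      also have "\<dots> \<le> z'" using z by (simp add: algebra_simps)
      finally show "(1 - \<epsilon>) powr p * z \<le> z'" .
    qed (use p z in auto)
    finally have 1: "(1 - \<epsilon>) * z powr (1 / p) \<le> z' powr (1 / p)" .
    have "z' powr (1 / p) \<le> ((1 + \<epsilon>) powr p * z) powr (1 / p)"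
    proof (rule powr_mono2)
      have "z' \<le> (1 + c * \<epsilon>) * z" using z by (simp add: algebra_simps)
      also have "\<dots> \<le> (1 + \<epsilon>) powr p * z" using up z by (intro mult_right_mono) auto
      finally show "z' \<le> (1 + \<epsilon>) powr p * z" .
    qed (use p z' in auto)
    also have "\<dots> = (1 + \<epsilon>) * z powr (1 / p)"
      using p \<epsilon> z by (simp add: powr_mult powr_powr)
    finally have 2: "z' powr (1 / p) \<le> (1 + \<epsilon>) * z powr (1 / p)" .
    show ?thesis using 1 2 False by (simp add: power_to_norm_def rel_approx_def)
  qed
  then show ?thesis using c by blast
qed

section \<open>Streaming algorithms as finite-state chains\<close>

text \<open>The run of an algorithm over an arbitrary state type, so that the sketch can be analysed
  on families of sets before states are encoded as words.\<close>

primrec chain :: "('u \<Rightarrow> 's \<Rightarrow> 's pmf) \<Rightarrow> 'u list \<Rightarrow> 's \<Rightarrow> 's pmf"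
  where
    "chain step [] \<sigma> = return_pmf \<sigma>"
  | "chain step (u # us) \<sigma> = bind_pmf (step u \<sigma>) (chain step us)"

lemma run_updates_eq_chain: "run_updates A us \<sigma> = chain (sa_update A) us \<sigma>"
  by (induction us arbitrary: \<sigma>) (auto intro: bind_pmf_cong)

text \<open>Copies updated with independent coins remain independent, because products commute with
  \<open>bind_pmf\<close>. The start state must equal \<open>d\<close> off \<open>I\<close>, as
  every outcome of \<open>Pi_pmf\<close> does.\<close>

lemma chain_Pi_pmf:
  assumes "finite I" "\<And>z. z \<notin> I \<Longrightarrow> \<sigma> z = d"
  shows "chain (\<lambda>u \<sigma>. Pi_pmf I d (\<lambda>z. f z u (\<sigma> z))) us \<sigma> = Pi_pmf I d (\<lambda>z. chain (f z) us (\<sigma> z))"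
  using assms(2)
proof (induction us arbitrary: \<sigma>)
  case Nil
  then have "(\<lambda>z. if z \<in> I then \<sigma> z else d) = \<sigma>" by auto
  then show ?case using assms(1) by simp
next
  case (Cons u us)
  have "Pi_pmf I d (\<lambda>z. chain (f z) (u # us) (\<sigma> z)) =
      bind_pmf (Pi_pmf I d (\<lambda>z. f z u (\<sigma> z))) (\<lambda>\<tau>. Pi_pmf I d (\<lambda>z. chain (f z) us (\<tau> z)))"
    by (simp add: Pi_pmf_bind[OF assms(1), where d' = d])
  also have "\<dots> = bind_pmf (Pi_pmf I d (\<lambda>z. f z u (\<sigma> z)))
      (chain (\<lambda>u \<sigma>. Pi_pmf I d (\<lambda>z. f z u (\<sigma> z))) us)"
  proof (rule bind_pmf_cong[OF refl])
    fix \<tau> assume "\<tau> \<in> set_pmf (Pi_pmf I d (\<lambda>z. f z u (\<sigma> z)))"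
    then have "\<And>z. z \<notin> I \<Longrightarrow> \<tau> z = d"
      using set_Pi_pmf_subset[OF assms(1)] by fast
    from Cons.IH[OF this] show "Pi_pmf I d (\<lambda>z. chain (f z) us (\<tau> z)) =
      chain (\<lambda>u \<sigma>. Pi_pmf I d (\<lambda>z. f z u (\<sigma> z))) us \<tau>" by simp
  qed
  finally show ?case by simp
qed

lemma finite_memory: "finite (memory b m)"
  and card_memory: "card (memory b m) = (2 ^ b) ^ m"
proof -
  have eq: "memory b m = {xs. set xs \<subseteq> {..<2 ^ b} \<and> length xs = m}"
    by (auto simp: memory_def)
  show "finite (memory b m)" unfolding eq by (rule finite_lists_length_eq) simp
  show "card (memory b m) = (2 ^ b) ^ m" unfolding eq by (subst card_lists_length_eq) auto
qed

text \<open>Memory contents are only a name for a state, since the update function is arbitrary.\<close>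

lemma finite_state_algorithm:
  fixes step :: "nat \<times> real \<Rightarrow> 's \<Rightarrow> 's pmf" and ans :: "nat set \<Rightarrow> 's \<Rightarrow> real"
  assumes Q: "finite Q" "card Q \<le> (2 ^ b) ^ m" "\<sigma>\<^sub>0 \<in> Q"
    and step: "\<And>u \<sigma>. \<sigma> \<in> Q \<Longrightarrow> set_pmf (step u \<sigma>) \<subseteq> Q"
  shows "\<exists>A. uses_words b m A \<and>
    (\<forall>us s. query_output A us s = map_pmf (ans s) (chain step us \<sigma>\<^sub>0))"
proof -
  obtain enc where enc: "enc ` Q \<subseteq> memory b m" "inj_on enc Q"
    using card_le_inj[OF Q(1) finite_memory[of b m]] Q(2) card_memory[of b m] by auto
  define dec where "dec = the_inv_into Q enc"
  have dec: "dec (enc \<sigma>) = \<sigma>" if "\<sigma> \<in> Q" for \<sigma>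
    using that enc(2) by (simp add: dec_def the_inv_into_f_f)
  \<comment> \<open>Words that encode no state are left fixed, since \<open>uses_words\<close>
    constrains the update on all memory contents and not only on reachable ones.\<close>
  define A where "A = \<lparr>sa_init = return_pmf (enc \<sigma>\<^sub>0),
    sa_update = (\<lambda>u w. if w \<in> enc ` Q then map_pmf enc (step u (dec w)) else return_pmf w),
    sa_answer = (\<lambda>s w. return_pmf (ans s (dec w)))\<rparr>"
  have "uses_words b m A"
    unfolding uses_words_def
  proof (intro conjI allI ballI)
    show "set_pmf (sa_init A) \<subseteq> memory b m"
      using enc(1) Q(3) by (auto simp: A_def)
    fix u w assume "w \<in> memory b m"
    moreover have "enc ` set_pmf (step u (dec w)) \<subseteq> memory b m" if "w \<in> enc ` Q"
    proof -
      have "dec w \<in> Q" using that dec by auto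
      then show ?thesis using step[of "dec w" u] enc(1) by blast
    qed
    ultimately show "set_pmf (sa_update A u w) \<subseteq> memory b m"
      by (simp add: A_def)
  qed
  moreover have run: "chain (sa_update A) us (enc \<sigma>) = map_pmf enc (chain step us \<sigma>)" 
    and in_Q: "set_pmf (chain step us \<sigma>) \<subseteq> Q" if "\<sigma> \<in> Q" for us \<sigma>
    using that
  proof (induction us arbitrary: \<sigma>)
    case Nil
    { case 1 show ?case by simp next case 2 then show ?case by simp }
  next
    case (Cons u us)
    { case 1
      have "chain (sa_update A) (u # us) (enc \<sigma>) =
          bind_pmf (step u \<sigma>) (\<lambda>\<tau>. chain (sa_update A) us (enc \<tau>))"
        using 1 dec by (simp add: A_def bind_map_pmf)
      also have "\<dots> = bind_pmf (step u \<sigma>) (\<lambda>\<tau>. map_pmf enc (chain step us \<tau>))"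
        by (rule bind_pmf_cong[OF refl]) (use step[OF 1, of u] Cons.IH(1) in blast)
      finally show ?case by (simp add: map_bind_pmf)
    next
      case 2
      then show ?case using step[OF 2, of u] Cons.IH(2) by fastforce }
  qed
  have "query_output A us s = map_pmf (ans s) (chain step us \<sigma>\<^sub>0)" for us s
  proof -
    have "query_output A us s = bind_pmf (chain step us \<sigma>\<^sub>0) (\<lambda>\<tau>. return_pmf (ans s (dec (enc \<tau>))))"
      using run[OF Q(3), of us]
      by (simp add: query_output_def run_updates_eq_chain bind_return_pmf bind_map_pmf A_def)
    also have "\<dots> = bind_pmf (chain step us \<sigma>\<^sub>0) (\<lambda>\<tau>. return_pmf (ans s \<tau>))"
      by (rule bind_pmf_cong[OF refl]) (use in_Q[OF Q(3), of us] dec in auto)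
    finally show ?thesis by (simp add: map_pmf_def)
  qed
  ultimately show ?thesis by blast
qed

section \<open>Random hit families\<close>

text \<open>The random set itself is never stored: inserting \<open>i\<close> into it just adds to
  its hit family the members of \<open>S\<close> containing \<open>i\<close>. An entry
  \<open>0\<close> has success probability \<open>0\<close>, also for \<open>p = 0\<close>, because
  \<open>0 powr 0 = 0\<close>.\<close>

definition hit_step :: "nat set set \<Rightarrow> real \<Rightarrow> real \<Rightarrow> nat \<times> real \<Rightarrow> nat set set \<Rightarrow> nat set set pmf"
  where "hit_step S p \<theta> = (\<lambda>(i, x) U.
    map_pmf (\<lambda>c. if c then U \<union> {s \<in> S. i \<in> s} else U)
      (bernoulli_pmf (1 - exp (- (\<theta> * \<bar>x\<bar> powr p)))))"

lemma set_hit_step: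
  assumes "U \<in> range (hit_family S)"
  shows "set_pmf (hit_step S p \<theta> u U) \<subseteq> range (hit_family S)"
proof -
  obtain i x where u: "u = (i, x)" by (cases u)
  obtain X where "U = hit_family S X" using assms by auto
  then have "U \<union> {s \<in> S. i \<in> s} = hit_family S (insert i X)"
    by (auto simp: hit_family_def)
  then show ?thesis using assms unfolding hit_step_def u by auto
qed

text \<open>A set stays unhit exactly when all coins of its own coordinates fail, and the
  independent failure probabilities multiply to the exponential of a sum. Different sets share
  coins, but the guarantee concerns one query at a time.\<close>

lemma prob_chain_hit_step:
  assumes "0 \<le> \<theta>" "s \<in> S"
  shows "measure_pmf.prob (chain (hit_step S p \<theta>) us U) {V. s \<notin> V} =
    (if s \<in> U then 0 else exp (- (\<theta> * (\<Sum>(i, x)\<leftarrow>us. if i \<in> s then \<bar>x\<bar> powr p else 0))))"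
proof (induction us arbitrary: U)
  case Nil
  show ?case by simp
next
  case (Cons u us)
  obtain i x where u: "u = (i, x)" by (cases u)
  define q where "q = exp (- (\<theta> * \<bar>x\<bar> powr p))"
  have q: "0 \<le> 1 - q" "1 - q \<le> 1" using assms(1) by (auto simp: q_def)
  let ?P = "\<lambda>U. measure_pmf.prob (chain (hit_step S p \<theta>) us U) {V. s \<notin> V}"
  have "measure_pmf.prob (chain (hit_step S p \<theta>) (u # us) U) {V. s \<notin> V} =
      ?P (U \<union> {s \<in> S. i \<in> s}) * (1 - q) + ?P U * q"
  proof -
    \<comment> \<open>The average over the two coin outcomes is evaluated in \<open>ennreal\<close>
      and brought back by injectivity on nonnegative reals.\<close>
    have "ennreal (measure_pmf.prob (chain (hit_step S p \<theta>) (u # us) U) {V. s \<notin> V}) =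
        ennreal (?P (U \<union> {s \<in> S. i \<in> s}) * (1 - q) + ?P U * q)"
      using q
      by (simp add: measure_pmf.emeasure_eq_measure[symmetric] u hit_step_def q_def[symmetric]
          ennreal_plus ennreal_mult)
    then show ?thesis using q by (subst (asm) ennreal_inj) auto
  qed
  then show ?case
    using assms(2) by (auto simp: Cons.IH u q_def algebra_simps simp flip: exp_add)
qed

text \<open>Distinctness turns the list sum into a sum over a set; coordinates absent from the
  stream have value \<open>0\<close> and contribute \<open>0 powr p = 0\<close>.\<close>

lemma stream_sum_eq:
  assumes "entrywise_stream n v us"
  shows "(\<Sum>(i, x)\<leftarrow>us. if i \<in> s then \<bar>x\<bar> powr p else 0) = (\<Sum>i = 1..n. \<bar>cprod (indicat_real s) v i\<bar> powr p)"
proof -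
  let ?g = "\<lambda>i. \<bar>cprod (indicat_real s) v i\<bar> powr p"
  have us: "distinct (map fst us)" "\<And>i x. (i, x) \<in> set us \<Longrightarrow> i \<in> {1..n} \<and> x = v i"
    "\<And>i. i \<in> {1..n} \<Longrightarrow> i \<notin> fst ` set us \<Longrightarrow> v i = 0"
    using assms unfolding entrywise_stream_def by auto
  have "map (\<lambda>(i, x). if i \<in> s then \<bar>x\<bar> powr p else 0) us = map ?g (map fst us)"
    using us(2) by (fastforce simp: cprod_def indicator_def)
  then have "(\<Sum>(i, x)\<leftarrow>us. if i \<in> s then \<bar>x\<bar> powr p else 0) = sum ?g (fst ` set us)"
    using sum_list_distinct_conv_sum_set[OF us(1), of ?g] by (simp only: set_map)
  also have "\<dots> = sum ?g {1..n}"
    by (rule sum.mono_neutral_left) (use us(2,3) in \<open>auto simp: cprod_def\<close>)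
  finally show ?thesis .
qed

text \<open>Chebyshev's inequality for the copies in \<open>J\<close>, a part of one larger product,
  so that all scales share a probability space. The factor \<open>q * (1 - q)\<close> is kept rather
  than bounded by \<open>1/4\<close>, since these factors are to telescope.\<close>

lemma Pi_pmf_frequency_deviation:
  fixes q \<delta> :: real
  assumes fin: "finite I" and J: "J \<subseteq> I" "J \<noteq> {}"
    and q: "\<And>z. z \<in> J \<Longrightarrow> measure_pmf.prob (\<mu> z) B = q" and \<delta>: "0 < \<delta>"
  shows "measure_pmf.prob (Pi_pmf I d \<mu>) {f. \<delta> \<le> \<bar>(\<Sum>z\<in>J. indicat_real B (f z)) / card J - q\<bar>}
    \<le> q * (1 - q) / (card J * \<delta>\<^sup>2)"
proof -
  define M where "M = measure_pmf (Pi_pmf I d \<mu>)"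
  define X where "X z f = indicat_real B (f z)" for z and f :: "'a \<Rightarrow> 'b"
  define r where "r = real (card J)"
  have finJ: "finite J" using J fin finite_subset by blast
  have r: "0 < r" using J finJ by (simp add: r_def card_gt_0_iff)
  have int: "integrable M g" if "\<And>f. \<bar>g f\<bar> \<le> c" for g :: "_ \<Rightarrow> real" and c
    unfolding M_def by (rule measure_pmf.integrable_const_bound[where B = c]) (use that in auto)
  have iX: "integrable M (X z)" for z
    by (rule int[of _ 1]) (auto simp: X_def indicator_def)
  have iXX: "integrable M (\<lambda>f. X z f * X w f)" for z w
    by (rule int[of _ 1]) (auto simp: X_def indicator_def)
  have joint: "(\<integral>f. X z f * X w f \<partial>M) = (if z = w then q else q * q)" if "z \<in> J" "w \<in> J" for z w
  proof -
    \<comment> \<open>With the factor \<open>1\<close> off \<open>{z, w}\<close>, one product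
      formula treats both cases: for \<open>z = w\<close> the set is a singleton and the product is
      the indicator itself, equal to its square.\<close>
    let ?h = "\<lambda>x y. if x \<in> {z, w} then indicat_real B y else 1"
    have zw: "{z, w} \<subseteq> I" using that J by auto
    have "(\<integral>f. (\<Prod>x\<in>I. ?h x (f x)) \<partial>M) = (\<Prod>x\<in>I. \<integral>y. ?h x y \<partial>\<mu> x)"
      unfolding M_def
      by (rule expectation_prod_Pi_pmf[OF fin])
        (auto intro!: measure_pmf.integrable_const_bound[where B = 1] simp: indicator_def)
    also have "(\<Prod>x\<in>I. \<integral>y. ?h x y \<partial>\<mu> x) = (\<Prod>x\<in>{z, w}. \<integral>y. ?h x y \<partial>\<mu> x)"
      by (rule prod.mono_neutral_right) (use fin zw in auto)
    also have "\<dots> = (\<Prod>x\<in>{z, w}. q)"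
      by (rule prod.cong) (use that q in auto)
    also have "(\<lambda>f. \<Prod>x\<in>I. ?h x (f x)) = (\<lambda>f. \<Prod>x\<in>{z, w}. ?h x (f x))"
      by (intro ext prod.mono_neutral_right) (use fin zw in auto)
    finally show ?thesis
      by (cases "z = w") (auto simp: X_def indicator_def simp flip: of_bool_conj)
  qed
  have mean: "(\<integral>f. X z f \<partial>M) = q" if "z \<in> J" for z
  proof -
    have "(\<lambda>f. X z f * X z f) = X z" by (auto simp: X_def indicator_def)
    then show ?thesis using joint[OF that that] by simp
  qed
  define Y where "Y f = (\<Sum>z\<in>J. X z f)" for f
  have Y2: "(\<lambda>f. (Y f)\<^sup>2) = (\<lambda>f. \<Sum>z\<in>J. \<Sum>w\<in>J. X z f * X w f)"
    by (auto simp: Y_def power2_eq_square sum_product)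
  have EY: "(\<integral>f. Y f \<partial>M) = r * q"
    unfolding Y_def using iX mean by (simp add: Bochner_Integration.integral_sum r_def)
  have "(\<integral>f. (Y f)\<^sup>2 \<partial>M) = (\<Sum>z\<in>J. \<Sum>w\<in>J. if z = w then q else q * q)"
    unfolding Y2 using iXX joint by (simp add: Bochner_Integration.integral_sum)
  also have "\<dots> = (\<Sum>z\<in>J. r * (q * q) + (q - q * q))"
  proof (rule sum.cong[OF refl])
    fix z assume "z \<in> J"
    have "(\<Sum>w\<in>J. if z = w then q else q * q) = (\<Sum>w\<in>J. q * q + (if z = w then q - q * q else 0))"
      by (rule sum.cong) auto
    also have "\<dots> = r * (q * q) + (q - q * q)"
      using \<open>z \<in> J\<close> finJ by (simp add: sum.distrib r_def)
    finally show "(\<Sum>w\<in>J. if z = w then q else q * q) = r * (q * q) + (q - q * q)" .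
  qed
  finally have EY2: "(\<integral>f. (Y f)\<^sup>2 \<partial>M) = r * (r * (q * q) + (q - q * q))"
    by (simp add: r_def)
  have iY: "integrable M Y" unfolding Y_def using iX by auto
  have iY2: "integrable M (\<lambda>f. (Y f)\<^sup>2)" unfolding Y2 using iXX by auto
  have "(\<integral>f. (Y f - r * q)\<^sup>2 \<partial>M) = (\<integral>f. (Y f)\<^sup>2 \<partial>M) - (r * q)\<^sup>2"
    using measure_pmf.variance_eq[of "Pi_pmf I d \<mu>" Y] iY iY2 EY by (simp add: M_def)
  also have "\<dots> = r * (q * (1 - q))"
    unfolding EY2 by (simp add: power2_eq_square algebra_simps)
  finally have var: "(\<integral>f. (Y f - r * q)\<^sup>2 \<partial>M) = r * (q * (1 - q))" .
  have "measure M {f \<in> space M. r * \<delta> \<le> \<bar>Y f - (\<integral>f. Y f \<partial>M)\<bar>} \<le> (\<integral>f. (Y f - (\<integral>f. Y f \<partial>M))\<^sup>2 \<partial>M) / (r * \<delta>)\<^sup>2"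
    unfolding M_def
    by (rule measure_pmf.Chebyshev_inequality) (use iY2 r \<delta> in \<open>auto simp: M_def\<close>)
  then have "measure M {f. r * \<delta> \<le> \<bar>Y f - r * q\<bar>} \<le> r * (q * (1 - q)) / (r * \<delta>)\<^sup>2"
    unfolding EY var by (simp add: M_def)
  also have "\<dots> = q * (1 - q) / (r * \<delta>\<^sup>2)"
    using r by (simp add: power2_eq_square)
  also have "{f. r * \<delta> \<le> \<bar>Y f - r * q\<bar>} = {f. \<delta> \<le> \<bar>Y f / r - q\<bar>}"
  proof -
    have "Y f / r - q = (Y f - r * q) / r" for f
      using r by (simp add: diff_divide_distrib)
    then have "\<bar>Y f / r - q\<bar> = \<bar>Y f - r * q\<bar> / r" for f
      using r by (simp only: abs_divide abs_of_pos)
    then show ?thesis using r by (simp add: field_simps)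
  qed
  finally show ?thesis by (simp add: M_def Y_def X_def r_def)
qed

section \<open>The sketch\<close>

lemma prob_dyadic_frequencies:
  fixes y \<delta> :: real and R :: nat
  assumes R: "0 < R" and \<delta>: "0 < \<delta>"
    and \<mu>: "\<And>k r. k \<le> M \<Longrightarrow> r < R \<Longrightarrow> measure_pmf.prob (\<mu> (k, r)) B = exp (- (y / 2 ^ k))"
  shows "measure_pmf.prob (Pi_pmf ({..M} \<times> {..<R}) d \<mu>)
      {f. \<forall>k\<le>M. \<bar>(\<Sum>r<R. indicat_real B (f (k, r))) / R - exp (- (y / 2 ^ k))\<bar> < \<delta>}
    \<ge> 1 - 1 / (R * \<delta>\<^sup>2)"
proof -
  let ?P = "Pi_pmf ({..M} \<times> {..<R}) d \<mu>"
  define D where "D k = {f. \<delta> \<le> \<bar>(\<Sum>r<R. indicat_real B (f (k, r))) / R - exp (- (y / 2 ^ k))\<bar>}" for k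
  have level: "measure_pmf.prob ?P (D k) \<le> exp (- (y / 2 ^ k)) * (1 - exp (- (y / 2 ^ k))) / (R * \<delta>\<^sup>2)"
    if "k \<le> M" for k
  proof -
    have "(\<Sum>z\<in>{k} \<times> {..<R}. indicat_real B (f z)) = (\<Sum>r<R. indicat_real B (f (k, r)))" for f
      by (simp add: sum.cartesian_product')
    then show ?thesis
      using Pi_pmf_frequency_deviation[of "{..M} \<times> {..<R}" "{k} \<times> {..<R}" \<mu> B "exp (- (y / 2 ^ k))" \<delta> d]
        that R \<delta> \<mu> by (auto simp: D_def card_cartesian_product)
  qed
  have "measure_pmf.prob ?P (\<Union>k\<le>M. D k) \<le> (\<Sum>k\<le>M. measure_pmf.prob ?P (D k))"
    by (rule measure_UNION_le) auto
  also have "\<dots> \<le> (\<Sum>k\<le>M. exp (- (y / 2 ^ k)) * (1 - exp (- (y / 2 ^ k))) / (R * \<delta>\<^sup>2))"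
    by (rule sum_mono) (use level in auto)
  also have "\<dots> = (exp (- (y / 2 ^ M)) - exp (- 2 * y)) / (R * \<delta>\<^sup>2)"
    by (simp only: dyadic_exp_variance_sum flip: sum_divide_distrib)
  also have "\<dots> \<le> 1 / (R * \<delta>\<^sup>2)"
  proof (rule divide_right_mono)
    \<comment> \<open>The exponential at scale \<open>M\<close> is at most \<open>1\<close> because
      it is a probability, namely that of copy \<open>0\<close>.\<close>
    have "measure_pmf.prob (\<mu> (M, 0)) B \<le> 1" by simp
    then have "exp (- (y / 2 ^ M)) \<le> 1" using \<mu>[of M 0] R by simp
    then show "exp (- (y / 2 ^ M)) - exp (- 2 * y) \<le> 1"
      using exp_gt_zero[of "- 2 * y"] by linarith
  qed simp
  finally have "measure_pmf.prob ?P (\<Union>k\<le>M. D k) \<le> 1 / (R * \<delta>\<^sup>2)" .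
  moreover have "measure_pmf.prob ?P (- (\<Union>k\<le>M. D k)) = 1 - measure_pmf.prob ?P (\<Union>k\<le>M. D k)"
    using measure_pmf.prob_compl[of "\<Union>k\<le>M. D k" ?P] by (simp add: Compl_eq_Diff_UNIV)
  moreover have "- (\<Union>k\<le>M. D k) =
      {f. \<forall>k\<le>M. \<bar>(\<Sum>r<R. indicat_real B (f (k, r))) / R - exp (- (y / 2 ^ k))\<bar> < \<delta>}"
    by (auto simp: D_def not_le)
  ultimately show ?thesis by simp
qed

text \<open>Any admissible value consistent with all frequencies will do. When the frequencies are
  accurate, the true value is a candidate, so the choice is meaningful.\<close>

definition dyadic_decode :: "nat \<Rightarrow> real \<Rightarrow> (nat \<Rightarrow> real) \<Rightarrow> real"
  where "dyadic_decode M \<delta> F = (SOME y. (y = 0 \<or> 1 \<le> y \<and> y \<le> 2 ^ M) \<and>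
    (\<forall>k\<le>M. \<bar>F k - exp (- (y / 2 ^ k))\<bar> < \<delta>))"

text \<open>The true and the decoded value are both within \<open>\<delta>\<close> of
  \<open>F\<close> at every scale, hence within \<open>2 * \<delta>\<close> of each other. The value
  \<open>0\<close> has to be recovered exactly; there the roles are swapped, and a decoded value of
  at least \<open>1\<close> would be less than itself.\<close>

lemma dyadic_decode_close:
  fixes y \<delta> :: real
  assumes y: "y = 0 \<or> 1 \<le> y \<and> y \<le> 2 ^ M" and \<delta>: "\<delta> < 1 / 32"
    and F: "\<And>k. k \<le> M \<Longrightarrow> \<bar>F k - exp (- (y / 2 ^ k))\<bar> < \<delta>"
  shows "\<bar>dyadic_decode M \<delta> F - y\<bar> \<le> 32 * \<delta> * y"
proof -
  define y' where "y' = dyadic_decode M \<delta> F"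
  have y': "(y' = 0 \<or> 1 \<le> y' \<and> y' \<le> 2 ^ M) \<and> (\<forall>k\<le>M. \<bar>F k - exp (- (y' / 2 ^ k))\<bar> < \<delta>)"
    unfolding y'_def dyadic_decode_def by (rule someI[of _ y]) (use y F in auto)
  have close: "\<bar>exp (- (y / 2 ^ k)) - exp (- (y' / 2 ^ k))\<bar> \<le> 2 * \<delta>" if "k \<le> M" for k
  proof -
    have "\<bar>F k - exp (- (y' / 2 ^ k))\<bar> < \<delta>" using y' that by blast
    then show ?thesis using F[OF that] by linarith
  qed
  show ?thesis
  proof (cases "y = 0")
    case False
    then have "\<bar>y' - y\<bar> \<le> 32 * \<delta> * y"
      using y y' \<delta> close by (intro dyadic_exp_close_imp_close[of y M y' \<delta>]) auto
    then show ?thesis by (simp add: y'_def)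
  next
    case True
    have "y' = 0"
    proof (rule ccontr)
      assume "y' \<noteq> 0"
      then have ge: "1 \<le> y'" "y' \<le> 2 ^ M" using y' by auto
      have "\<bar>y - y'\<bar> \<le> 32 * \<delta> * y'"
        by (rule dyadic_exp_close_imp_close[OF ge]) (use True \<delta> close in \<open>auto simp: abs_minus_commute\<close>)
      moreover have "32 * \<delta> * y' < 1 * y'" using ge \<delta> by (intro mult_strict_right_mono) auto
      ultimately show False using True ge by simp
    qed
    then show ?thesis using True by (simp add: y'_def)
  qed
qed

lemma lpnorm_eq_power_to_norm: "lpnorm n p v = power_to_norm p (\<Sum>i = 1..n. \<bar>v i\<bar> powr p)"
proof (cases "p = 0")
  case True
  have "(\<Sum>i = 1..n. \<bar>v i\<bar> powr 0) = (\<Sum>i\<in>vsupp n v. 1)"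
    by (rule sum.mono_neutral_cong_right) (auto simp: vsupp_def)
  then show ?thesis using True by (simp add: lpnorm_def power_to_norm_def)
qed (simp add: lpnorm_def power_to_norm_def)

text \<open>Nonzero summands lie between \<open>2 powr (- (p * b))\<close> and
  \<open>2 powr (p * b)\<close>, and there are at most \<open>2 ^ b\<close> of them. The
  \<open>1\<close> in \<open>p + 1 <= real a\<close> pays for the number of summands.\<close>

lemma power_sum_range:
  fixes p :: real and s :: "nat set"
  assumes p: "0 \<le> p" "p + 1 \<le> real a" and n: "n \<le> 2 ^ b" and v: "word_range b n v"
  defines "y \<equiv> 2 ^ (a * b) * (\<Sum>i = 1..n. \<bar>cprod (indicat_real s) v i\<bar> powr p)"
  shows "y = 0 \<or> 1 \<le> y \<and> y \<le> 2 ^ (2 * a * b)"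
proof -
  define w where "w i = \<bar>cprod (indicat_real s) v i\<bar> powr p" for i
  have w0: "0 \<le> w i" for i by (simp add: w_def)
  have range: "w i = 0 \<or> 2 powr (- (p * b)) \<le> w i \<and> w i \<le> 2 powr (p * b)" if "i \<in> {1..n}" for i
  proof (cases "i \<in> s \<and> v i \<noteq> 0")
    case True
    then have "1 / 2 ^ b \<le> \<bar>v i\<bar>" "\<bar>v i\<bar> \<le> 2 ^ b" using v that by (auto simp: word_range_def)
    then have "2 powr (- real b) \<le> \<bar>v i\<bar>" "\<bar>v i\<bar> \<le> 2 powr (real b)"
      by (auto simp: powr_minus powr_realpow divide_inverse)
    then have "(2 powr (- real b)) powr p \<le> \<bar>v i\<bar> powr p" "\<bar>v i\<bar> powr p \<le> (2 powr real b) powr p"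
      using p by (auto intro!: powr_mono2)
    moreover have "w i = \<bar>v i\<bar> powr p" using True by (simp add: w_def cprod_def)
    ultimately show ?thesis by (simp add: powr_powr mult.commute)
  next
    case False
    then show ?thesis by (auto simp: w_def cprod_def)
  qed
  have y: "y = 2 ^ (a * b) * (\<Sum>i = 1..n. w i)" by (simp add: y_def w_def)
  have pb: "p * b + b \<le> real (a * b)"
    using mult_right_mono[OF p(2), of "real b"] by (simp add: algebra_simps)
  show ?thesis
  proof (cases "\<forall>i\<in>{1..n}. w i = 0")
    case True
    then show ?thesis by (simp add: y)
  next
    case False
    then obtain i where i: "i \<in> {1..n}" "w i \<noteq> 0" by blast
    have "1 \<le> 2 powr (real (a * b)) * 2 powr (- (p * b))"
      using pb by (simp add: ge_one_powr_ge_zero flip: powr_add)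
    also have "\<dots> \<le> 2 powr (real (a * b)) * w i"
      using range[OF i(1)] i(2) by (intro mult_left_mono) auto
    also have "\<dots> \<le> 2 powr (real (a * b)) * (\<Sum>i = 1..n. w i)"
      by (intro mult_left_mono member_le_sum) (use i w0 in auto)
    finally have "1 \<le> y" unfolding y by (subst (asm) powr_realpow) auto
    moreover have "y \<le> 2 ^ (2 * a * b)"
    proof -
      have "(\<Sum>i = 1..n. w i) \<le> (\<Sum>i = 1..n. 2 powr (p * b))"
        by (rule sum_mono) (use range in force)
      also have "\<dots> = real n * 2 powr (p * b)" by simp
      also have "\<dots> \<le> 2 powr b * 2 powr (p * b)"
      proof (rule mult_right_mono)
        have "real n \<le> real (2 ^ b)" using n by (simp only: of_nat_le_iff)
        then show "real n \<le> 2 powr b" by (simp add: powr_realpow)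
      qed simp
      also have "\<dots> \<le> 2 powr (real (a * b))" using pb by (simp add: add.commute flip: powr_add)
      also have "\<dots> = 2 ^ (a * b)" by (rule powr_realpow) simp
      finally have "y \<le> 2 ^ (a * b) * 2 ^ (a * b)" unfolding y by (intro mult_left_mono) auto
      then show ?thesis by (simp add: mult.assoc flip: power_add mult_2)
    qed
    ultimately show ?thesis by simp
  qed
qed

lemma hit_sketch_algorithm:
  fixes p \<epsilon> c :: real
  assumes p: "0 \<le> p" "p + 1 \<le> real a" and c: "0 < c" "c < 1"
    and norm: "\<And>z z'. 0 \<le> z \<Longrightarrow> \<bar>z' - z\<bar> \<le> c * \<epsilon> * z \<Longrightarrow>
      power_to_norm p z' \<in> rel_approx \<epsilon> (power_to_norm p z)"
    and S: "S \<subseteq> Pow {1..n}" and \<epsilon>: "0 < \<epsilon>" "\<epsilon> < 1" and n: "n \<le> 2 ^ b"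
    and R: "10240 / (c * \<epsilon>)\<^sup>2 \<le> real R"
    and m: "((card S + 1) ^ HHdim n S) ^ ((2 * a * b + 1) * R) \<le> (2 ^ b) ^ m"
  shows "\<exists>A. uses_words b m A \<and>
    (\<forall>v us. word_range b n v \<longrightarrow> entrywise_stream n v us \<longrightarrow>
      (\<forall>s\<in>S. measure_pmf.prob (query_output A us s)
        (rel_approx \<epsilon> (lpnorm n p (cprod (indicat_real s) v))) \<ge> 9 / 10))"
proof -
  define M where "M = 2 * a * b"
  define I where "I = {..M} \<times> {..<R}"
  \<comment> \<open>This factor lifts a nonzero power sum to at least \<open>1\<close>, while
    \<open>M\<close> scales reach its largest value. Dividing \<open>c * \<epsilon>\<close> by 32 in
    \<open>\<delta>\<close> cancels the 32 of \<open>dyadic_decode_close\<close>.\<close>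
  define \<Theta> :: real where "\<Theta> = 2 ^ (a * b)"
  define \<delta> where "\<delta> = c * \<epsilon> / 32"
  define f where "f z = hit_step S p (\<Theta> / 2 ^ fst z)" for z :: "nat \<times> nat"
  define step where "step u \<sigma> = Pi_pmf I {} (\<lambda>z. f z u (\<sigma> z))" for u \<sigma>
  define freq where "freq s \<sigma> k = (\<Sum>r<R. indicat_real {V. s \<notin> V} (\<sigma> (k, r))) / R"
    for s :: "nat set" and \<sigma> :: "nat \<times> nat \<Rightarrow> nat set set" and k
  define ans where "ans s \<sigma> = power_to_norm p (dyadic_decode M \<delta> (freq s \<sigma>) / \<Theta>)" for s \<sigma>
  define Q where "Q = PiE_dflt I {} (\<lambda>_. range (hit_family S))"
  have c\<epsilon>: "0 < c * \<epsilon>" "c * \<epsilon> < 1" using c \<epsilon> mult_strict_mono[of c 1 \<epsilon> 1] by auto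
  have \<delta>: "0 < \<delta>" "\<delta> < 1 / 32" using c\<epsilon> by (auto simp: \<delta>_def)
  have \<Theta>: "0 < \<Theta>" by (simp add: \<Theta>_def)
  have R0: "0 < R" using R c\<epsilon> by (cases R) (auto simp: divide_le_0_iff)
  \<comment> \<open>Here \<open>10240 = 10 * 32 ^ 2\<close>: the 32 comes from
    \<open>\<delta>\<close>, the 10 from the allowed failure probability
    \<open>1/10\<close>.\<close>
  have R\<delta>: "1 / (R * \<delta>\<^sup>2) \<le> 1 / 10"
  proof -
    have "10240 \<le> R * (c * \<epsilon>)\<^sup>2" using R pos_divide_le_eq[of "(c * \<epsilon>)\<^sup>2" 10240 R] c \<epsilon> by simp
    then have "10 \<le> R * \<delta>\<^sup>2" by (simp add: \<delta>_def power_divide)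
    then show ?thesis by (simp add: divide_le_eq)
  qed
  have finS: "finite S" using S finite_subset by auto
  have finI: "finite I" by (simp add: I_def)
  have fin_fam: "finite (range (hit_family S))"
    by (rule finite_subset[of _ "Pow S"]) (use finS in \<open>auto simp: hit_family_def\<close>)
  have "card Q = card (range (hit_family S)) ^ card I"
    unfolding Q_def by (subst card_PiE_dflt) (use finI fin_fam in auto)
  also have "\<dots> \<le> ((card S + 1) ^ HHdim n S) ^ card I"
    by (rule power_mono) (use card_hit_families[OF S] in auto)
  also have "card I = (2 * a * b + 1) * R" by (simp add: I_def M_def)
  finally have cardQ: "card Q \<le> (2 ^ b) ^ m" using m by simp
  have finQ: "finite Q" unfolding Q_def using finI fin_fam by auto
  have "{} = hit_family S {}" by (auto simp: hit_family_def)
  then have init: "(\<lambda>_. {}) \<in> Q" by (auto simp: Q_def PiE_dflt_def)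
  \<comment> \<open>Every copy remains a hit family after an update, so the small count of
    \<open>Q\<close> covers all reachable states.\<close>
  have "set_pmf (step u \<sigma>) \<subseteq> Q" if "\<sigma> \<in> Q" for u \<sigma>
  proof
    fix \<tau> assume "\<tau> \<in> set_pmf (step u \<sigma>)"
    then have \<tau>: "\<tau> \<in> PiE_dflt I {} (set_pmf \<circ> (\<lambda>z. f z u (\<sigma> z)))"
      unfolding step_def set_Pi_pmf[OF finI] .
    have "\<tau> z \<in> range (hit_family S)" if "z \<in> I" for z
    proof -
      have "\<sigma> z \<in> range (hit_family S)" using \<open>\<sigma> \<in> Q\<close> that unfolding Q_def PiE_dflt_def by blast
      moreover have "\<tau> z \<in> set_pmf (f z u (\<sigma> z))" using \<tau> that by (simp add: PiE_dflt_def del: split_paired_All)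
      ultimately show ?thesis using set_hit_step unfolding f_def by blast
    qed
    then show "\<tau> \<in> Q" using \<tau> by (simp add: Q_def PiE_dflt_def del: split_paired_All)
  qed
  from finite_state_algorithm[where step = step and ans = ans, OF finQ cardQ init this]
  obtain A where A: "uses_words b m A"
    "\<And>us s. query_output A us s = map_pmf (ans s) (chain step us (\<lambda>_. {}))" by blast
  have "measure_pmf.prob (query_output A us s)
      (rel_approx \<epsilon> (lpnorm n p (cprod (indicat_real s) v))) \<ge> 9 / 10"
    if v: "word_range b n v" and us: "entrywise_stream n v us" and s: "s \<in> S" for v us s
  proof -
    define z where "z = (\<Sum>i = 1..n. \<bar>cprod (indicat_real s) v i\<bar> powr p)"
    define y where "y = \<Theta> * z"
    have z: "0 \<le> z" by (simp add: z_def sum_nonneg)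
    have y: "y = 0 \<or> 1 \<le> y \<and> y \<le> 2 ^ M"
      using power_sum_range[OF p n v, of s] by (simp add: y_def z_def \<Theta>_def M_def)
    have run: "chain step us (\<lambda>_. {}) = Pi_pmf I {} (\<lambda>z. chain (f z) us {})"
      unfolding step_def by (rule chain_Pi_pmf[OF finI]) simp
    have "measure_pmf.prob (chain (f (k, r)) us {}) {V. s \<notin> V} = exp (- (y / 2 ^ k))" for k r
      unfolding f_def using s \<Theta>
      by (simp add: prob_chain_hit_step stream_sum_eq[OF us] y_def z_def)
    then have "9 / 10 \<le> measure_pmf.prob (chain step us (\<lambda>_. {}))
        {\<sigma>. \<forall>k\<le>M. \<bar>freq s \<sigma> k - exp (- (y / 2 ^ k))\<bar> < \<delta>}"
      using prob_dyadic_frequencies[OF R0 \<delta>(1), of M "\<lambda>z. chain (f z) us {}" "{V. s \<notin> V}" y "{}"] R\<delta>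
      unfolding run I_def freq_def by simp
    also have "\<dots> \<le> measure_pmf.prob (chain step us (\<lambda>_. {}))
        (ans s -` rel_approx \<epsilon> (lpnorm n p (cprod (indicat_real s) v)))"
    proof (rule measure_pmf.finite_measure_mono)
      show "{\<sigma>. \<forall>k\<le>M. \<bar>freq s \<sigma> k - exp (- (y / 2 ^ k))\<bar> < \<delta>} \<subseteq>
        ans s -` rel_approx \<epsilon> (lpnorm n p (cprod (indicat_real s) v))"
      proof
        fix \<sigma> assume "\<sigma> \<in> {\<sigma>. \<forall>k\<le>M. \<bar>freq s \<sigma> k - exp (- (y / 2 ^ k))\<bar> < \<delta>}"
        then have "\<bar>dyadic_decode M \<delta> (freq s \<sigma>) - y\<bar> \<le> 32 * \<delta> * y"
          by (intro dyadic_decode_close[OF y \<delta>(2)]) auto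
        then have "\<bar>dyadic_decode M \<delta> (freq s \<sigma>) - y\<bar> / \<Theta> \<le> 32 * \<delta> * y / \<Theta>"
          using \<Theta> by (intro divide_right_mono) auto
        moreover have "\<bar>dyadic_decode M \<delta> (freq s \<sigma>) - y\<bar> / \<Theta> = \<bar>dyadic_decode M \<delta> (freq s \<sigma>) / \<Theta> - z\<bar>"
        proof -
          have "dyadic_decode M \<delta> (freq s \<sigma>) / \<Theta> - z = (dyadic_decode M \<delta> (freq s \<sigma>) - y) / \<Theta>"
            using \<Theta> by (simp add: y_def diff_divide_distrib)
          then show ?thesis using \<Theta> by (simp only: abs_divide abs_of_pos)
        qed
        moreover have "32 * \<delta> * y / \<Theta> = c * \<epsilon> * z"
          using \<Theta> by (simp add: y_def \<delta>_def)
        ultimately have "ans s \<sigma> \<in> rel_approx \<epsilon> (power_to_norm p z)"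
          unfolding ans_def by (intro norm z) simp
        then show "\<sigma> \<in> ans s -` rel_approx \<epsilon> (lpnorm n p (cprod (indicat_real s) v))"
          by (simp add: lpnorm_eq_power_to_norm z_def)
      qed
    qed simp
    finally show ?thesis by (simp add: A(2))
  qed
  then show ?thesis using A(1) by blast
qed

section \<open>Choice of the parameters and count of the words\<close>

theorem mainTheorem7:
  fixes p :: real
  assumes "p \<ge> 0"
  shows "\<exists>C::real. C > 0 \<and>
    (\<forall>(n::nat) (b::nat) (S :: nat set set) (\<epsilon>::real).
      S \<subseteq> Pow {1..n} \<longrightarrow> 0 < \<epsilon> \<longrightarrow> \<epsilon> < 1 \<longrightarrow> 1 \<le> b \<longrightarrow> n \<le> 2 ^ b \<longrightarrow>
      (\<exists>(A :: stream_alg) (m::nat).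
        real m \<le> C * real (HHdim n S) * (1 / \<epsilon>\<^sup>2) * max 1 (log 2 (real (card S))) \<and>
        uses_words b m A \<and>
        (\<forall>v us. word_range b n v \<longrightarrow> entrywise_stream n v us \<longrightarrow>
          (\<forall>s\<in>S. measure_pmf.prob (query_output A us s)
              (rel_approx \<epsilon> (lpnorm n p (cprod (indicat_real s) v))) \<ge> 9 / 10))))"
proof -
  have nat_ceiling_le: "real (nat \<lceil>x\<rceil>) \<le> x + 1" if "0 \<le> x" for x :: real
    using that by linarith
  obtain c where c: "0 < c" "c < 1"
    and norm: "\<And>\<epsilon> z z'. 0 < \<epsilon> \<Longrightarrow> \<epsilon> < 1 \<Longrightarrow> 0 \<le> z \<Longrightarrow> \<bar>z' - z\<bar> \<le> c * \<epsilon> * z \<Longrightarrow>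
      power_to_norm p z' \<in> rel_approx \<epsilon> (power_to_norm p z)"
    using power_to_norm_approx[OF assms] by blast
  obtain a :: nat where a: "p + 1 \<le> real a" using real_arch_simple by blast
  have a1: "1 \<le> a" using a assms by simp
  \<comment> \<open>The 9 is the 3 in \<open>m\<close> times the 3 in \<open>l_le\<close>;
    \<open>a\<close> and \<open>c\<close> depend on \<open>p\<close> only.\<close>
  define C where "C = 9 * real a * (10240 / c\<^sup>2 + 1)"
  have C: "0 < C" using a1 c by (auto simp: C_def add_pos_pos)
  have "\<exists>(A :: stream_alg) (m::nat).
      real m \<le> C * real (HHdim n S) * (1 / \<epsilon>\<^sup>2) * max 1 (log 2 (real (card S))) \<and>
      uses_words b m A \<and>
      (\<forall>v us. word_range b n v \<longrightarrow> entrywise_stream n v us \<longrightarrow>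
        (\<forall>s\<in>S. measure_pmf.prob (query_output A us s)
          (rel_approx \<epsilon> (lpnorm n p (cprod (indicat_real s) v))) \<ge> 9 / 10))"
    if S: "S \<subseteq> Pow {1..n}" and \<epsilon>: "0 < \<epsilon>" "\<epsilon> < 1" and b: "1 \<le> b" "n \<le> 2 ^ b" for n b S \<epsilon>
  proof -
    define K where "K = card S"
    define d where "d = HHdim n S"
    define L where "L = max 1 (log 2 (real K))"
    define R where "R = nat \<lceil>10240 / (c * \<epsilon>)\<^sup>2\<rceil>"
    define l where "l = nat \<lceil>log 2 (real (K + 1))\<rceil>"
    \<comment> \<open>The states need at most \<open>l * d * R * (2 * a * b + 1)\<close> bits. As
      \<open>2 * a * b + 1 <= 3 * a * b\<close>, this fits into \<open>m\<close> words of
      \<open>b\<close> bits, and \<open>b\<close> drops out of the word count.\<close>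
    define m where "m = 3 * a * d * R * l"
    have R: "10240 / (c * \<epsilon>)\<^sup>2 \<le> real R" unfolding R_def by (rule real_nat_ceiling_ge)
    have R_le: "real R \<le> (10240 / c\<^sup>2 + 1) * (1 / \<epsilon>\<^sup>2)"
    proof -
      have "real R \<le> 10240 / (c * \<epsilon>)\<^sup>2 + 1"
        unfolding R_def by (rule nat_ceiling_le) simp
      also have "1 \<le> 1 / \<epsilon>\<^sup>2" using \<epsilon> by (simp add: power_le_one)
      finally show ?thesis by (simp add: power_mult_distrib algebra_simps)
    qed
    have l: "K + 1 \<le> 2 ^ l"
    proof -
      have "log 2 (real (K + 1)) \<le> real l" unfolding l_def by (rule real_nat_ceiling_ge)
      then have "real (K + 1) \<le> 2 powr real l" by (subst (asm) log_le_iff) auto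
      also have "\<dots> = real (2 ^ l)" by (simp add: powr_realpow)
      finally show ?thesis by (simp only: of_nat_le_iff)
    qed
    \<comment> \<open>For \<open>K >= 1\<close>, passing from \<open>K\<close> to
      \<open>K + 1\<close> costs at most \<open>1\<close> in the logarithm and rounding up another
      \<open>1\<close>; both are absorbed by \<open>L >= 1\<close>.\<close>
    have l_le: "real l \<le> 3 * L"
    proof (cases "K = 0")
      case True
      then show ?thesis by (simp add: l_def L_def)
    next
      case False
      then have "log 2 (real (K + 1)) \<le> log 2 (2 * real K)" by simp
      also have "\<dots> = 1 + log 2 (real K)" using False by (simp add: log_mult)
      finally have "log 2 (real (K + 1)) \<le> 2 * L" by (auto simp: L_def)
      moreover have "real l \<le> log 2 (real (K + 1)) + 1"
        unfolding l_def by (rule nat_ceiling_le) simp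
      ultimately show ?thesis by (auto simp: L_def)
    qed
    have "real m = 3 * real a * real d * (real R * real l)" by (simp add: m_def)
    also have "\<dots> \<le> 3 * real a * real d * (((10240 / c\<^sup>2 + 1) * (1 / \<epsilon>\<^sup>2)) * (3 * L))"
      by (intro mult_left_mono mult_mono R_le l_le) (auto simp: L_def)
    also have "\<dots> = C * real d * (1 / \<epsilon>\<^sup>2) * L" by (simp add: C_def)
    finally have m_le: "real m \<le> C * real d * (1 / \<epsilon>\<^sup>2) * L" .
    have "((K + 1) ^ d) ^ ((2 * a * b + 1) * R) \<le> ((2 ^ l) ^ d) ^ ((2 * a * b + 1) * R)"
      by (intro power_mono l) auto
    also have "\<dots> = 2 ^ (l * d * R * (2 * a * b + 1))"
      by (simp only: power_mult[symmetric] ac_simps)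
    also have "\<dots> \<le> 2 ^ (l * d * R * (3 * a * b))"
      using a1 b(1) by (intro power_increasing mult_left_mono) auto
    also have "\<dots> = (2 ^ b) ^ m"
      by (simp only: power_mult[symmetric] m_def ac_simps)
    finally have m: "((card S + 1) ^ HHdim n S) ^ ((2 * a * b + 1) * R) \<le> (2 ^ b) ^ m"
      by (simp add: K_def d_def)
    show ?thesis
      using hit_sketch_algorithm[OF assms a c norm[OF \<epsilon>] S \<epsilon> b(2) R m] m_le
      unfolding K_def d_def L_def by blast
  qed
  then show ?thesis using C by blast
qed

end
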